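(* Let $k\geq 1$ be an integer and let $G$ be the Tanner graph of a variable-regular LDPC code with column weight $\gamma$. Suppose $G$ has girth $g=2(2k+2)$. Then there is no $(a,b)$ elementary trapping set in $G$ with $\frac{b}{a}<1$ of size $a\leq 2(\gamma-2)^k$.
   Context: A Tanner graph is a finite simple bipartite graph with vertex classes $V$ (variable nodes) and $C$ (check nodes). The code is variable-regular with column weight $\gamma$ if every variable node has degree $\gamma$ in the Tanner graph. The girth is the length of a shortest cycle. For a nonempty subset $S\subseteq V$ with $|S|=a$, consider the subgraph of the Tanner graph induced by $S$ together with all check nodes adjacent to some element of $S$; if exactly $b$ of these check nodes have odd degree in this subgraph, it is called an $(a,b)$ trapping set of size $a$. It is an elementary trapping set (ETS) if every one of these check nodes has degree $1$ or $2$ in the subgraph (so $b$ is the number of degree-one check nodes). *)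

theory Defs
  imports Complex_Main "HOL-Library.Extended_Nat"
begin

text \<open>
  Undirected edges are two-element sets of vertices, so simplicity of the graph is part of the
  encoding. In a Tanner graph every edge joins a variable node in \<open>V\<close> to a check node in \<open>C\<close>.
\<close>

definition tanner_graph :: "'a set \<Rightarrow> 'a set \<Rightarrow> 'a set set \<Rightarrow> bool" where
  "tanner_graph V C E \<longleftrightarrow>
     finite V \<and> finite C \<and> V \<inter> C = {} \<and> E \<subseteq> {{v, c} | v c. v \<in> V \<and> c \<in> C}"

definition degree :: "'a set set \<Rightarrow> 'a \<Rightarrow> nat" where
  "degree E x = card {e \<in> E. x \<in> e}"

definition variable_regular :: "'a set \<Rightarrow> 'a set set \<Rightarrow> nat \<Rightarrow> bool" where
  "variable_regular V E \<gamma> \<longleftrightarrow> (\<forall>v\<in>V. degree E v = \<gamma>)"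

text \<open>
  A cycle is the list of its distinct vertices, without repeating the first one at the end; hence
  its length is the length of the list. The requirement of at least three vertices excludes
  traversing a single edge back and forth.
\<close>

definition is_cycle :: "'a set set \<Rightarrow> 'a list \<Rightarrow> bool" where
  "is_cycle E xs \<longleftrightarrow>
     3 \<le> length xs \<and> distinct xs \<and>
     (\<forall>i<length xs. {xs ! i, xs ! (Suc i mod length xs)} \<in> E)"

text \<open>The girth of an acyclic graph is \<open>\<infinity>\<close>.\<close>

definition girth :: "'a set set \<Rightarrow> enat" where
  "girth E = (INF xs \<in> {xs. is_cycle E xs}. enat (length xs))"

definition induced_edges :: "'a set set \<Rightarrow> 'a set \<Rightarrow> 'a set set" where
  "induced_edges E W = {e \<in> E. e \<subseteq> W}"

definition adjacent_checks :: "'a set \<Rightarrow> 'a set set \<Rightarrow> 'a set \<Rightarrow> 'a set" where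
  "adjacent_checks C E S = {c \<in> C. \<exists>v\<in>S. {v, c} \<in> E}"

definition trapping_edges :: "'a set \<Rightarrow> 'a set set \<Rightarrow> 'a set \<Rightarrow> 'a set set" where
  "trapping_edges C E S = induced_edges E (S \<union> adjacent_checks C E S)"

definition trapping_set ::
    "'a set \<Rightarrow> 'a set \<Rightarrow> 'a set set \<Rightarrow> nat \<Rightarrow> nat \<Rightarrow> 'a set \<Rightarrow> bool" where
  "trapping_set V C E a b S \<longleftrightarrow>
     S \<noteq> {} \<and> S \<subseteq> V \<and> card S = a \<and>
     card {c \<in> adjacent_checks C E S. odd (degree (trapping_edges C E S) c)} = b"

definition elementary_trapping_set ::
    "'a set \<Rightarrow> 'a set \<Rightarrow> 'a set set \<Rightarrow> nat \<Rightarrow> nat \<Rightarrow> 'a set \<Rightarrow> bool" where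
  "elementary_trapping_set V C E a b S \<longleftrightarrow>
     trapping_set V C E a b S \<and>
     (\<forall>c\<in>adjacent_checks C E S. degree (trapping_edges C E S) c \<in> {1, 2})"

end

theory Submission imports Defs begin

text \<open>
  In an elementary trapping set the checks of degree two are the edges of a multigraph on the \<open>a\<close>
  variable nodes, whose average degree is \<open>\<gamma> - b / a > \<gamma> - 1\<close>. The irregular Moore bound of Alon,
  Hoory and Linial applies to it. After passing to a subgraph of minimum degree two, the average
  over the oriented edges \<open>e\<close> of the logarithm of the number \<open>w(e)\<close> of non-backtracking walks with
  \<open>k\<close> steps after \<open>e\<close> is at least \<open>k\<close> times the average of \<open>ln (d - 1)\<close> for the degree \<open>d\<close> of the
  head of \<open>e\<close>, by Jensen's inequality, and this exceeds \<open>k * ln (\<gamma> - 2)\<close> by the convexity of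
  \<open>d * ln (d - 1)\<close>. So some \<open>e\<close> with reversal \<open>e'\<close> has \<open>w(e) * w(e') > (\<gamma> - 2)^(2 * k)\<close>, whence
  \<open>w(e) + w(e') > 2 * (\<gamma> - 2)^k\<close>. By the girth condition these walks all have different ends, so
  \<open>a > 2 * (\<gamma> - 2)^k\<close>.
\<close>

section \<open>Non-backtracking walks\<close>

text \<open>Only immediate reversals \<open>x, y, x\<close> are excluded; vertices may otherwise
  recur.\<close>

fun nb_walk :: "'a set set \<Rightarrow> 'a list \<Rightarrow> bool" where
  "nb_walk E (x # y # z # zs) \<longleftrightarrow> {x, y} \<in> E \<and> x \<noteq> z \<and> nb_walk E (y # z # zs)"
| "nb_walk E [x, y] \<longleftrightarrow> {x, y} \<in> E"
| "nb_walk E _ \<longleftrightarrow> True"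

lemma nb_walk_Cons_Cons:
  "nb_walk E (x # y # zs) \<longleftrightarrow> {x, y} \<in> E \<and> (zs \<noteq> [] \<longrightarrow> x \<noteq> hd zs) \<and> nb_walk E (y # zs)"
  by (cases zs) auto

lemma nb_walk_tl: "nb_walk E (x # xs) \<Longrightarrow> nb_walk E xs"
  by (cases xs) (auto simp: nb_walk_Cons_Cons)

lemma nb_walk_edge:
  assumes "nb_walk E xs" "Suc i < length xs"
  shows "{xs ! i, xs ! Suc i} \<in> E"
  using assms
proof (induction xs arbitrary: i)
  case (Cons x xs)
  then show ?case
    by (cases xs; cases i) (auto simp: nb_walk_Cons_Cons)
qed simp

text \<open>The induction moves the head of \<open>xs\<close> across the joint; the last hypothesis
  rules out a reversal at \<open>x\<close>.\<close>

lemma nb_walk_join: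
  assumes "nb_walk E (x # xs)" "nb_walk E (x # ys)"
    and "xs \<noteq> [] \<Longrightarrow> ys \<noteq> [] \<Longrightarrow> hd xs \<noteq> hd ys"
  shows "nb_walk E (rev xs @ x # ys)"
  using assms
proof (induction xs arbitrary: x ys)
  case (Cons y xs)
  have "nb_walk E (y # x # ys)"
    using Cons.prems by (auto simp: nb_walk_Cons_Cons insert_commute)
  moreover have "nb_walk E (y # xs)"
    using Cons.prems(1) by (rule nb_walk_tl)
  moreover have "xs \<noteq> [] \<Longrightarrow> hd xs \<noteq> x"
    using Cons.prems(1) by (auto simp: nb_walk_Cons_Cons)
  ultimately show ?case
    using Cons.IH[of y "x # ys"] by simp
qed simp

text \<open>Front vertices are stripped until the rest is distinct; then \<open>x\<close> recurs in
  the rest, and the segment up to that recurrence closes a cycle.\<close>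

lemma nb_walk_imp_cycle:
  assumes "nb_walk E xs" "\<not> distinct xs" and no_loop: "\<And>x. {x} \<notin> E"
  shows "\<exists>ys. is_cycle E ys \<and> length ys < length xs"
  using assms(1,2)
proof (induction xs)
  case (Cons x zs)
  show ?case
  proof (cases "distinct zs")
    case False
    then show ?thesis
      using Cons nb_walk_tl by fastforce
  next
    case True
    then have "x \<in> set zs"
      using Cons.prems by simp
    then obtain us vs where zs: "zs = us @ x # vs"
      by (meson split_list)
    have walk: "nb_walk E (x # us @ x # vs)"
      using Cons.prems zs by simp
    \<comment> \<open>An empty \<open>us\<close> would give a loop at \<open>x\<close>, a single
      vertex an immediate reversal.\<close>
    have len: "2 \<le> length us"
    proof (rule ccontr)
      assume "\<not> 2 \<le> length us"
      then consider "us = []" | u where "us = [u]"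
        by (cases us; cases "tl us") auto
      then show False
        using walk no_loop by cases (auto simp: nb_walk_Cons_Cons)
    qed
    have "is_cycle E (x # us)"
      unfolding is_cycle_def
    proof (intro conjI allI impI)
      fix i assume i: "i < length (x # us)"
      have e: "{(x # us @ x # vs) ! i, (x # us @ x # vs) ! Suc i} \<in> E"
        using nb_walk_edge[OF walk] i by simp
      have 1: "(x # us @ x # vs) ! i = (x # us) ! i"
        using i by (auto simp: nth_Cons' nth_append)
      \<comment> \<open>At \<open>i = length us\<close> the index wraps to 0, and the second
        occurrence of \<open>x\<close> stands for the first.\<close>
      have 2: "(x # us @ x # vs) ! Suc i = (x # us) ! (Suc i mod length (x # us))"
        using i by (cases "i = length us") (auto simp: nth_append)
      show "{(x # us) ! i, (x # us) ! (Suc i mod length (x # us))} \<in> E"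
        using e unfolding 1 2 .
    qed (use len True zs in auto)
    then show ?thesis
      using zs by (intro exI[of _ "x # us"]) auto
  qed
qed simp

section \<open>Counting non-backtracking walks\<close>

text \<open>Jensen's inequality for the logarithm, from \<open>ln z \<le> z - 1\<close> at the
  ratios of the values to their mean \<open>m\<close>.\<close>

lemma sum_ln_le_ln_sum:
  fixes f :: "'b \<Rightarrow> real"
  assumes "finite A" "A \<noteq> {}" "\<And>x. x \<in> A \<Longrightarrow> 0 < f x"
  shows "ln (card A) + (\<Sum>x\<in>A. ln (f x)) / card A \<le> ln (\<Sum>x\<in>A. f x)"
proof -
  define n where "n = real (card A)"
  define m where "m = (\<Sum>x\<in>A. f x) / n"
  have n: "n > 0"
    using assms(1,2) by (simp add: n_def card_gt_0_iff)
  have sum_pos: "(\<Sum>x\<in>A. f x) > 0"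
    using assms by (simp add: sum_pos)
  have m: "m > 0"
    using sum_pos n by (simp add: m_def)
  have "(\<Sum>x\<in>A. ln (f x) - ln m) \<le> (\<Sum>x\<in>A. f x / m - 1)"
  proof (rule sum_mono)
    fix x assume "x \<in> A"
    then show "ln (f x) - ln m \<le> f x / m - 1"
      using ln_le_minus_one[of "f x / m"] assms(3)[of x] m by (simp add: ln_div)
  qed
  also have "\<dots> = (\<Sum>x\<in>A. f x) / m - n"
    by (simp add: sum_subtractf sum_divide_distrib n_def)
  also have "\<dots> = 0"
    using n m sum_pos by (simp add: m_def)
  finally have "(\<Sum>x\<in>A. ln (f x)) \<le> n * ln m"
    by (simp add: sum_subtractf n_def)
  then have "(\<Sum>x\<in>A. ln (f x)) / n \<le> ln m"
    using n by (simp add: field_simps)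
  also have "ln m = ln (\<Sum>x\<in>A. f x) - ln n"
    using n sum_pos by (simp add: m_def ln_div)
  finally show ?thesis
    by (simp add: n_def)
qed

text \<open>Tangent line of the function \<open>(y + 1) * ln y\<close>, which is convex on \<open>y \<ge> 1\<close> only.\<close>

lemma tangent_le_mult_ln:
  fixes s y :: real
  assumes "s \<ge> 1" "y \<ge> 1"
  shows "(s + 1) / s * (y - s) \<le> (y + 1) * (ln y - ln s)"
proof -
  \<comment> \<open>\<open>h\<close> vanishes at \<open>s\<close>; its derivative \<open>h'\<close>
    is at most 0 on \<open>[1, s]\<close> and at least 0 beyond, so \<open>s\<close> minimises
    \<open>h\<close> on \<open>x \<ge> 1\<close>.\<close>
  define h where "h x = (x + 1) * (ln x - ln s) - (s + 1) / s * (x - s)" for x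
  define h' where "h' x = ln x - ln s + (1 / x - 1 / s)" for x
  have deriv: "(h has_real_derivative h' x) (at x)" if "x > 0" for x
    unfolding h_def h'_def using that assms(1)
    by (auto intro!: derivative_eq_intros simp: field_simps)
  have h's: "h' x \<ge> 0" if "x \<ge> s" for x
  proof -
    have "1 - s / x \<le> ln x - ln s"
      using ln_le_minus_one[of "s / x"] that assms(1) by (simp add: ln_div)
    moreover have "1 / s - 1 / x \<le> 1 - s / x"
    proof -
      have "1 / s - 1 / x = (1 - s / x) / s"
        using that assms(1) by (simp add: field_simps)
      also have "\<dots> \<le> (1 - s / x) / 1"
        using that assms(1) by (intro divide_left_mono) auto
      finally show ?thesis by simp
    qed
    ultimately show ?thesis by (simp add: h'_def)
  qed
  have h'l: "h' x \<le> 0" if "1 \<le> x" "x \<le> s" for x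
  proof -
    have "ln x - ln s \<le> x / s - 1"
      using ln_le_minus_one[of "x / s"] that assms(1) by (simp add: ln_div)
    moreover have "1 / x - 1 / s \<le> 1 - x / s"
    proof -
      have "1 / x - 1 / s = (1 - x / s) / x"
        using that assms(1) by (simp add: field_simps)
      also have "\<dots> \<le> (1 - x / s) / 1"
        using that assms(1) by (intro divide_left_mono) auto
      finally show ?thesis by simp
    qed
    ultimately show ?thesis by (simp add: h'_def)
  qed
  have "h s \<le> h y"
  proof (cases "s \<le> y")
    case True
    then show ?thesis
      using assms by (intro DERIV_nonneg_imp_nondecreasing[of s y h]) (auto intro!: deriv h's exI)
  next
    case False
    then show ?thesis
      using assms by (intro DERIV_nonpos_imp_nonincreasing[of y s h]) (auto intro!: deriv h'l exI)
  qed
  then show ?thesis by (simp add: h_def)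
qed

text \<open>
  A finite multigraph is given by its set \<open>D\<close> of darts (oriented edges), the orientation
  reversal \<open>r\<close> and the tail \<open>t\<close> of a dart; the head of \<open>e\<close> is \<open>t (r e)\<close>.
\<close>

locale dart_graph =
  fixes D :: "'e set" and r :: "'e \<Rightarrow> 'e" and t :: "'e \<Rightarrow> 'v"
  assumes finite_darts: "finite D"
    and rev_in: "e \<in> D \<Longrightarrow> r e \<in> D"
    and rev_rev: "e \<in> D \<Longrightarrow> r (r e) = e"
begin

definition out :: "'v \<Rightarrow> nat" where
  "out x = card {f \<in> D. t f = x}"

text \<open>Only the reversal itself is excluded: a walk may return to the previous vertex along a
  parallel edge.\<close>

definition nexts :: "'e \<Rightarrow> 'e set" where
  "nexts e = {f \<in> D. t f = t (r e) \<and> f \<noteq> r e}"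

fun walks :: "nat \<Rightarrow> 'e \<Rightarrow> nat" where
  "walks 0 e = 1"
| "walks (Suc j) e = (\<Sum>f\<in>nexts e. walks j f)"

fun ends :: "nat \<Rightarrow> 'e \<Rightarrow> 'v set" where
  "ends 0 e = {t (r e)}"
| "ends (Suc j) e = (\<Union>f\<in>nexts e. ends j f)"

lemma finite_nexts: "finite (nexts e)"
  using finite_darts by (simp add: nexts_def)

lemma nexts_subset: "nexts e \<subseteq> D"
  by (auto simp: nexts_def)

lemma bij_rev: "bij_betw r D D"
  by (rule bij_betw_byWitness[where f' = r]) (auto simp: rev_in rev_rev)

lemma card_nexts: "e \<in> D \<Longrightarrow> card (nexts e) = out (t (r e)) - 1"
proof -
  assume e: "e \<in> D"
  have "nexts e = {f \<in> D. t f = t (r e)} - {r e}"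
    by (auto simp: nexts_def)
  then show ?thesis
    using rev_in[OF e] finite_darts by (simp add: out_def)
qed

text \<open>Reversal turns the predecessors of \<open>f\<close> into the other darts with the same
  tail as \<open>f\<close>.\<close>

lemma card_prevs: "f \<in> D \<Longrightarrow> card {e \<in> D. f \<in> nexts e} = out (t f) - 1"
proof -
  assume f: "f \<in> D"
  have "bij_betw r {e \<in> D. f \<in> nexts e} ({e \<in> D. t e = t f} - {f})"
    by (rule bij_betw_byWitness[where f' = r]) (use f in \<open>auto simp: rev_in rev_rev nexts_def\<close>)
  then have "card {e \<in> D. f \<in> nexts e} = card ({e \<in> D. t e = t f} - {f})"
    by (rule bij_betw_same_card)
  then show ?thesis
    using f finite_darts by (simp add: out_def)
qed

lemma finite_ends: "finite (ends j e)"
  by (induction j arbitrary: e) (auto simp: finite_nexts)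

lemma ends_subset: "e \<in> D \<Longrightarrow> ends j e \<subseteq> t ` D"
proof (induction j arbitrary: e)
  case (Suc j)
  then show ?case
    using nexts_subset[of e] by fastforce
qed (auto simp: rev_in)

text \<open>Disjointness at every branching makes different walks end in different vertices.\<close>

lemma card_ends:
  assumes "\<And>i e f f'. i < j \<Longrightarrow> e \<in> D \<Longrightarrow> f \<in> nexts e \<Longrightarrow> f' \<in> nexts e \<Longrightarrow> f \<noteq> f' \<Longrightarrow>
             ends i f \<inter> ends i f' = {}"
    and "e \<in> D"
  shows "card (ends j e) = walks j e"
  using assms
proof (induction j arbitrary: e)
  case (Suc j)
  have "card (ends (Suc j) e) = (\<Sum>f\<in>nexts e. card (ends j f))"
    unfolding ends.simps
    by (rule card_UN_disjoint) (use Suc.prems in \<open>auto simp: finite_nexts finite_ends\<close>)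
  also have "\<dots> = (\<Sum>f\<in>nexts e. walks j f)"
  proof (intro sum.cong refl)
    fix f assume "f \<in> nexts e"
    then have "f \<in> D" using nexts_subset by blast
    then show "card (ends j f) = walks j f"
      using Suc.prems(1) by (intro Suc.IH) auto
  qed
  finally show ?case by simp
qed simp

section \<open>Walk counts under minimum degree two\<close>

context
  assumes min_degree: "e \<in> D \<Longrightarrow> 2 \<le> out (t e)"
begin

lemma nexts_nonempty: "e \<in> D \<Longrightarrow> nexts e \<noteq> {}"
  using card_nexts[of e] min_degree[of "r e"] rev_in[of e] by (auto)

lemma walks_pos: "e \<in> D \<Longrightarrow> 0 < walks j e"
proof (induction j arbitrary: e)
  case (Suc j)
  have "0 < walks j f" if "f \<in> nexts e" for f
    using Suc.IH that nexts_subset by blast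
  then have "0 < (\<Sum>f\<in>nexts e. walks j f)"
    using nexts_nonempty[OF Suc.prems] finite_nexts by (intro sum_pos)
  then show ?case by simp
qed simp

text \<open>
  The random non-backtracking walk preserves the uniform distribution on darts, so that Jensen's
  inequality for the logarithm can be iterated.
\<close>

lemma sum_ln_walks:
  "real j * (\<Sum>e\<in>D. ln (real (card (nexts e)))) \<le> (\<Sum>e\<in>D. ln (real (walks j e)))"
proof (induction j)
  case (Suc j)
  let ?w = "\<lambda>e. ln (real (walks j e))"
  let ?q = "\<lambda>e. real (card (nexts e))"
  \<comment> \<open>Double counting: \<open>f\<close> has \<open>out (t f) - 1\<close> predecessors
    \<open>e\<close>, each with \<open>?q e = out (t f) - 1\<close>, so its weights
    \<open>1 / ?q e\<close> add up to 1.\<close>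
  have "(\<Sum>e\<in>D. (\<Sum>f\<in>nexts e. ?w f) / ?q e) = (\<Sum>e\<in>D. \<Sum>f | f \<in> D \<and> f \<in> nexts e. ?w f / ?q e)"
    using nexts_subset by (auto intro!: sum.cong simp: sum_divide_distrib)
  also have "\<dots> = (\<Sum>f\<in>D. \<Sum>e | e \<in> D \<and> f \<in> nexts e. ?w f / ?q e)"
    using finite_darts finite_darts by (rule sum.swap_restrict)
  also have "\<dots> = (\<Sum>f\<in>D. ?w f)"
  proof (rule sum.cong[OF refl])
    fix f assume f: "f \<in> D"
    have "(\<Sum>e | e \<in> D \<and> f \<in> nexts e. ?w f / ?q e) =
          (\<Sum>e | e \<in> D \<and> f \<in> nexts e. ?w f / real (out (t f) - 1))"
      by (intro sum.cong refl) (auto simp: card_nexts, auto simp: nexts_def)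
    also have "\<dots> = ?w f"
      using card_prevs[OF f] min_degree[OF f] by simp
    finally show "(\<Sum>e | e \<in> D \<and> f \<in> nexts e. ?w f / ?q e) = ?w f" .
  qed
  finally have swap: "(\<Sum>e\<in>D. (\<Sum>f\<in>nexts e. ?w f) / ?q e) = (\<Sum>f\<in>D. ?w f)" .
  have "real (Suc j) * (\<Sum>e\<in>D. ln (?q e)) \<le> (\<Sum>e\<in>D. ln (?q e)) + (\<Sum>e\<in>D. ?w e)"
    using Suc.IH by (simp add: algebra_simps)
  also have "\<dots> = (\<Sum>e\<in>D. ln (?q e) + (\<Sum>f\<in>nexts e. ?w f) / ?q e)"
    using swap by (simp add: sum.distrib)
  also have "\<dots> \<le> (\<Sum>e\<in>D. ln (\<Sum>f\<in>nexts e. real (walks j f)))"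
  proof (rule sum_mono)
    fix e assume "e \<in> D"
    then show "ln (?q e) + (\<Sum>f\<in>nexts e. ?w f) / ?q e \<le> ln (\<Sum>f\<in>nexts e. real (walks j f))"
      using nexts_subset[of e] walks_pos
      by (intro sum_ln_le_ln_sum finite_nexts nexts_nonempty) auto
  qed
  finally show ?case by simp
qed simp

text \<open>If all products were at most \<open>s ^ (2 * k)\<close>, the logarithms of
  \<open>walks k\<close> would sum to at most \<open>card D * k * ln s\<close>; density and
  \<open>sum_ln_walks\<close> put the sum above that.\<close>

lemma exists_many_walks:
  fixes s :: nat
  assumes "1 \<le> k" "1 \<le> s" and dense: "(s + 1) * card (t ` D) < card D"
  shows "\<exists>e\<in>D. s ^ (2 * k) < walks k e * walks k (r e)"
proof (rule ccontr)
  assume "\<not> ?thesis"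
  then have le: "walks k e * walks k (r e) \<le> s ^ (2 * k)" if "e \<in> D" for e
    using that by (auto simp: not_less)
  let ?w = "\<lambda>e. ln (real (walks k e))"
  have rev_sum: "(\<Sum>e\<in>D. g (r e)) = (\<Sum>e\<in>D. g e)" for g :: "'e \<Rightarrow> real"
    by (rule sum.reindex_bij_betw[OF bij_rev])
  \<comment> \<open>A vertex counts once per dart leaving it, which yields the factor
    \<open>y + 1\<close> of the tangent inequality at \<open>y = out x - 1\<close>.\<close>
  have fibres: "(\<Sum>e\<in>D. g (t e)) = (\<Sum>x\<in>t ` D. real (out x) * g x)" for g :: "'v \<Rightarrow> real"
  proof -
    have "(\<Sum>e\<in>D. g (t e)) = (\<Sum>x\<in>t ` D. \<Sum>e | e \<in> D \<and> t e = x. g (t e))"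
      using finite_darts by (rule sum.image_gen)
    also have "\<dots> = (\<Sum>x\<in>t ` D. real (out x) * g x)"
      by (intro sum.cong refl) (simp add: out_def)
    finally show ?thesis .
  qed
  have card_D: "real (card D) = (\<Sum>x\<in>t ` D. real (out x))"
    using fibres[of "\<lambda>_. 1"] by simp
  have "0 < (real s + 1) / s * (real (card D) - (s + 1) * card (t ` D))"
  proof -
    have "real ((s + 1) * card (t ` D)) < real (card D)"
      using dense by (simp only: of_nat_less_iff)
    then show ?thesis using assms(2) by simp
  qed
  also have "\<dots> = (\<Sum>x\<in>t ` D. (real s + 1) / s * (real (out x) - 1 - s))"
  proof -
    have "(\<Sum>x\<in>t ` D. real (out x) - 1 - s) = real (card D) - (s + 1) * card (t ` D)"
      by (simp add: card_D sum_subtractf algebra_simps)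
    then show ?thesis by (metis sum_distrib_left)
  qed
  also have "\<dots> \<le> (\<Sum>x\<in>t ` D. real (out x) * (ln (real (out x - 1)) - ln s))"
  proof (rule sum_mono)
    fix x assume "x \<in> t ` D"
    then have "2 \<le> out x" using min_degree by blast
    then show "(real s + 1) / s * (real (out x) - 1 - s) \<le>
        real (out x) * (ln (real (out x - 1)) - ln s)"
      using tangent_le_mult_ln[of s "real (out x) - 1"] assms(2) by (simp add: of_nat_diff)
  qed
  also have "\<dots> = (\<Sum>e\<in>D. ln (real (out (t e) - 1)) - ln s)"
    by (rule fibres[symmetric])
  also have "\<dots> = (\<Sum>e\<in>D. ln (real (out (t (r e)) - 1))) - card D * ln s"
    by (simp add: sum_subtractf rev_sum[of "\<lambda>e. ln (real (out (t e) - Suc 0))"])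
  also have "\<dots> = (\<Sum>e\<in>D. ln (real (card (nexts e)))) - card D * ln s"
    by (simp add: card_nexts)
  finally have "card D * ln s < (\<Sum>e\<in>D. ln (real (card (nexts e))))"
    by simp
  then have "k * (card D * ln s) < k * (\<Sum>e\<in>D. ln (real (card (nexts e))))"
    using assms(1) by (intro mult_strict_left_mono) auto
  also have "\<dots> \<le> (\<Sum>e\<in>D. ?w e)"
    by (rule sum_ln_walks)
  finally have lower: "2 * k * card D * ln s < 2 * (\<Sum>e\<in>D. ?w e)"
    by simp
  have "2 * (\<Sum>e\<in>D. ?w e) = (\<Sum>e\<in>D. ?w e + ?w (r e))"
    by (simp add: sum.distrib rev_sum[of ?w])
  also have "\<dots> \<le> (\<Sum>e\<in>D. 2 * k * ln s)"
  proof (rule sum_mono)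
    fix e assume e: "e \<in> D"
    have pos: "0 < walks k e" "0 < walks k (r e)"
      using e rev_in walks_pos by auto
    have "?w e + ?w (r e) = ln (real (walks k e * walks k (r e)))"
      using pos by (simp add: ln_mult)
    also have "\<dots> \<le> ln (real (s ^ (2 * k)))"
      using pos le[OF e] assms(2) by (subst ln_le_cancel_iff) (auto simp del: of_nat_mult of_nat_power)
    also have "\<dots> = 2 * k * ln s"
      using assms(2) by (simp add: ln_realpow)
    finally show "?w e + ?w (r e) \<le> 2 * k * ln s" .
  qed
  finally show False
    using lower by (simp add: mult.assoc mult.left_commute)
qed

end

end

section \<open>Subsets of variable nodes without checks of degree three\<close>

locale elementary =
  fixes E :: "'a set set" and S :: "'a set"
  assumes finite_nodes: "finite (\<Union>E)"
    and finite_S: "finite S"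
    and no_loop: "{x} \<notin> E"
    and two_neighbours: "u \<in> S \<Longrightarrow> v \<in> S \<Longrightarrow> w \<in> S \<Longrightarrow> {u, c} \<in> E \<Longrightarrow> {v, c} \<in> E \<Longrightarrow> {w, c} \<in> E \<Longrightarrow>
      u \<noteq> v \<Longrightarrow> w = u \<or> w = v"
begin

text \<open>
  The variable nodes of \<open>T\<close> are the vertices and the checks with two neighbours in \<open>T\<close> are the
  edges of a multigraph; a pair \<open>(v, c)\<close> is the edge \<open>c\<close> oriented away from \<open>v\<close>.
\<close>

definition darts :: "'a set \<Rightarrow> ('a \<times> 'a) set" where
  "darts T = {(v, c). v \<in> T \<and> {v, c} \<in> E \<and> (\<exists>w\<in>T. w \<noteq> v \<and> {w, c} \<in> E)}"

text \<open>By \<open>two_neighbours\<close> the choice is unique on darts. It ranges over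
  \<open>S\<close>, so that one reversal serves every \<open>T \<subseteq> S\<close>.\<close>

definition opposite :: "'a \<times> 'a \<Rightarrow> 'a \<times> 'a" where
  "opposite e = (SOME w. w \<in> S \<and> w \<noteq> fst e \<and> {w, snd e} \<in> E, snd e)"

lemma opposite_eq:
  assumes "v \<in> S" "w \<in> S" "v \<noteq> w" "{v, c} \<in> E" "{w, c} \<in> E"
  shows "opposite (v, c) = (w, c)"
proof -
  have "(SOME w. w \<in> S \<and> w \<noteq> v \<and> {w, c} \<in> E) = w"
    using assms two_neighbours by (intro some_equality) blast+
  then show ?thesis by (simp add: opposite_def)
qed

lemma darts_E:
  assumes "e \<in> darts T" "T \<subseteq> S"
  obtains v w c where "e = (v, c)" "opposite e = (w, c)" "v \<in> T" "w \<in> T" "v \<noteq> w"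
    "{v, c} \<in> E" "{w, c} \<in> E"
proof -
  obtain v c w where e: "e = (v, c)" "v \<in> T" "w \<in> T" "v \<noteq> w" "{v, c} \<in> E" "{w, c} \<in> E"
    using assms(1) by (auto simp: darts_def)
  moreover have "opposite e = (w, c)"
    using e assms(2) opposite_eq by blast
  ultimately show ?thesis using that by blast
qed

lemma finite_darts_set: "finite (darts T)"
  by (rule finite_subset[of _ "\<Union>E \<times> \<Union>E"]) (auto simp: darts_def finite_nodes)

lemma dart_graph_darts: "T \<subseteq> S \<Longrightarrow> dart_graph (darts T) opposite"
proof
  assume T: "T \<subseteq> S"
  show "opposite e \<in> darts T" if "e \<in> darts T" for e
    using that T by (elim darts_E) (auto simp: darts_def)
  show "opposite (opposite e) = e" if "e \<in> darts T" for e
    using that T by (elim darts_E) (auto intro: opposite_eq)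
qed (rule finite_darts_set)

lemma fst_darts: "fst ` darts T \<subseteq> T"
  by (auto simp: darts_def)

text \<open>
  Deleting a vertex of degree at most one keeps the average degree above \<open>s + 1 \<ge> 2\<close>.
\<close>

lemma dense_subset_min_degree:
  fixes s :: nat
  assumes "1 \<le> s" "(s + 1) * card S < card (darts S)"
  obtains T where "T \<subseteq> S" "(s + 1) * card T < card (darts T)"
    "\<And>v. v \<in> T \<Longrightarrow> 2 \<le> card {e \<in> darts T. fst e = v}"
proof -
  let ?P = "\<lambda>T. T \<subseteq> S \<and> (s + 1) * card T < card (darts T)"
  \<comment> \<open>A smallest dense subset: a vertex of degree at most one could be deleted from
    it.\<close>
  obtain T where T: "?P T" and min: "\<And>U. ?P U \<Longrightarrow> card T \<le> card U"
    using ex_has_least_nat[of ?P S card] assms(2) by blast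
  interpret dart_graph "darts T" opposite fst
    using T dart_graph_darts by blast
  have "2 \<le> card {e \<in> darts T. fst e = v}" if v: "v \<in> T" for v
  proof (rule ccontr)
    let ?A = "{e \<in> darts T. fst e = v}"
    assume "\<not> 2 \<le> card ?A"
    then have A: "card ?A \<le> 1" by simp
    have "finite T" using T finite_S finite_subset by blast
    then have card_T: "card T = Suc (card (T - {v}))"
      using v by (rule card.remove)
    \<comment> \<open>A dart lost with \<open>v\<close> leaves \<open>v\<close> or is the reversal
      of one that does.\<close>
    have "e \<in> darts (T - {v}) \<union> (?A \<union> opposite ` ?A)" if e: "e \<in> darts T" for e
    proof -
      obtain u w c where e': "e = (u, c)" "opposite e = (w, c)" "u \<in> T" "w \<in> T" "u \<noteq> w"
        "{u, c} \<in> E" "{w, c} \<in> E"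
        using e T by (auto elim: darts_E)
      consider "u = v" | "w = v" | "u \<noteq> v" "w \<noteq> v" by blast
      then show ?thesis
      proof cases
        case 2
        then have "fst (opposite e) = v" using e'(2) by simp
        then have "opposite e \<in> ?A" using rev_in[OF e] by blast
        then have "opposite (opposite e) \<in> opposite ` ?A" by (rule imageI)
        then show ?thesis using rev_rev[OF e] by simp
      next
        case 1
        then have "e \<in> ?A" using e e'(1) by simp
        then show ?thesis by blast
      next
        case 3
        then have "(u, c) \<in> darts (T - {v})"
          using e'(3-7) by (auto simp: darts_def)
        then show ?thesis using e'(1) by blast
      qed
    qed
    then have "card (darts T) \<le> card (darts (T - {v}) \<union> (?A \<union> opposite ` ?A))"
      by (intro card_mono) (auto simp: finite_darts_set)
    also have "\<dots> \<le> card (darts (T - {v})) + (card ?A + card (opposite ` ?A))"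
      by (meson card_Un_le add_left_mono order_trans)
    also have "\<dots> \<le> card (darts (T - {v})) + 2"
      using A card_image_le[of ?A opposite] finite_darts by simp
    \<comment> \<open>At most two darts are lost, while the left side drops by
      \<open>s + 1 \<ge> 2\<close>.\<close>
    finally have "(s + 1) * card (T - {v}) < card (darts (T - {v}))"
      using T card_T assms(1) by simp
    then show False
      using min[of "T - {v}"] T card_T by auto
  qed
  with T that show ?thesis by blast
qed

section \<open>Walks in the Tanner graph and the girth\<close>

context
  fixes T
  assumes T: "T \<subseteq> S"
begin

interpretation dart_graph "darts T" opposite fst
  using T by (rule dart_graph_darts)

text \<open>Each dart unfolds to tail, check, head, so a step of the multigraph is two steps in the
  Tanner graph.\<close>

lemma ends_nb_walk:
  assumes "e \<in> darts T" "x \<in> ends j e"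
  shows "\<exists>zs. nb_walk E (fst e # snd e # fst (opposite e) # zs) \<and>
           last (fst (opposite e) # zs) = x \<and> length zs = 2 * j"
  using assms
proof (induction j arbitrary: e)
  case 0
  then show ?case
    using T by (elim darts_E) (auto simp: insert_commute)
next
  case (Suc j)
  obtain f where f: "f \<in> nexts e" "x \<in> ends j f"
    using Suc.prems(2) by auto
  then have fD: "f \<in> darts T" using nexts_subset by blast
  obtain zs where zs: "nb_walk E (fst f # snd f # fst (opposite f) # zs)"
      "last (fst (opposite f) # zs) = x" "length zs = 2 * j"
    using Suc.IH[OF fD f(2)] by blast
  obtain v w c where e: "e = (v, c)" "opposite e = (w, c)" "v \<noteq> w" "{v, c} \<in> E" "{w, c} \<in> E"
    using Suc.prems(1) T by (auto elim: darts_E)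
  \<comment> \<open>Darts with the same tail differ in their checks, so the unfolded walk does not
    reverse at \<open>w\<close>.\<close>
  have "fst f = w" "snd f \<noteq> c"
    using f(1) e by (auto simp: nexts_def prod_eq_iff)
  then have "nb_walk E (v # c # w # snd f # fst (opposite f) # zs)"
    using zs(1) e by (auto simp: insert_commute)
  then show ?case
    using e zs by (intro exI[of _ "snd f # fst (opposite f) # zs"]) auto
qed

text \<open>Two walks leaving the common tail through different checks and meeting again would join
  to a walk on \<open>4 * i + 5\<close> vertices with a repetition, hence give a shorter
  cycle.\<close>

lemma ends_nexts_disjoint:
  assumes girth: "\<And>xs. is_cycle E xs \<Longrightarrow> 4 * i + 5 \<le> length xs"
    and "e \<in> darts T" "f \<in> nexts e" "f' \<in> nexts e" "f \<noteq> f'"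
  shows "ends i f \<inter> ends i f' = {}"
proof (rule ccontr)
  assume "\<not> ?thesis"
  then obtain x where x: "x \<in> ends i f" "x \<in> ends i f'" by blast
  have fD: "f \<in> darts T" "f' \<in> darts T"
    using assms(3,4) nexts_subset by blast+
  have fst: "fst f' = fst f" "snd f \<noteq> snd f'"
    using assms by (auto simp: nexts_def prod_eq_iff)
  obtain zs where zs: "nb_walk E (fst f # snd f # fst (opposite f) # zs)"
      "last (fst (opposite f) # zs) = x" "length zs = 2 * i"
    using ends_nb_walk[OF fD(1) x(1)] by blast
  obtain zs' where zs': "nb_walk E (fst f # snd f' # fst (opposite f') # zs')"
      "last (fst (opposite f') # zs') = x" "length zs' = 2 * i"
    using ends_nb_walk[OF fD(2) x(2)] fst by auto
  let ?ws = "rev (snd f # fst (opposite f) # zs) @ fst f # snd f' # fst (opposite f') # zs'"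
  have "nb_walk E ?ws"
    using zs(1) zs'(1) fst by (intro nb_walk_join) auto
  moreover have "\<not> distinct ?ws"
    using last_in_set[of "fst (opposite f) # zs"] last_in_set[of "fst (opposite f') # zs'"] zs zs'
    by auto
  ultimately obtain ys where "is_cycle E ys" "length ys < length ?ws"
    using nb_walk_imp_cycle no_loop by blast
  then show False
    using girth[of ys] zs zs' by simp
qed

text \<open>Here the two walks are joined at the check of \<open>e\<close>, which gives
  \<open>4 * i + 3\<close> vertices.\<close>

lemma ends_opposite_disjoint:
  assumes girth: "\<And>xs. is_cycle E xs \<Longrightarrow> 4 * i + 3 \<le> length xs"
    and e: "e \<in> darts T"
  shows "ends i e \<inter> ends i (opposite e) = {}"
proof (rule ccontr)
  assume "\<not> ?thesis"
  then obtain x where x: "x \<in> ends i e" "x \<in> ends i (opposite e)" by blast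
  obtain v w c where vw: "e = (v, c)" "opposite e = (w, c)" "v \<noteq> w"
    using e T by (auto elim: darts_E)
  obtain zs where zs: "nb_walk E (v # c # w # zs)" "last (w # zs) = x" "length zs = 2 * i"
    using ends_nb_walk[OF e x(1)] vw by auto
  obtain zs' where zs': "nb_walk E (w # c # v # zs')" "last (v # zs') = x" "length zs' = 2 * i"
    using ends_nb_walk[OF rev_in[OF e] x(2)] rev_rev[OF e] vw by auto
  let ?ws = "rev (w # zs) @ c # v # zs'"
  have "nb_walk E ?ws"
    using zs(1) zs'(1) vw(3) by (intro nb_walk_join) (auto simp del: nb_walk.simps dest: nb_walk_tl)
  moreover have "\<not> distinct ?ws"
    using last_in_set[of "w # zs"] last_in_set[of "v # zs'"] zs zs' by auto
  ultimately obtain ys where "is_cycle E ys" "length ys < length ?ws"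
    using nb_walk_imp_cycle no_loop by blast
  then show False
    using girth[of ys] zs zs' by simp
qed

lemma walks_opposite_le:
  assumes girth: "\<And>xs. is_cycle E xs \<Longrightarrow> 4 * k + 3 \<le> length xs"
    and e: "e \<in> darts T"
  shows "walks k e + walks k (opposite e) \<le> card T"
proof -
  have card: "card (ends k f) = walks k f" if "f \<in> darts T" for f
  proof (rule card_ends[OF ends_nexts_disjoint that])
    show "4 * i + 5 \<le> length xs" if "i < k" "is_cycle E xs" for i xs
      using girth[OF that(2)] that(1) by linarith
  qed
  have "walks k e + walks k (opposite e) = card (ends k e \<union> ends k (opposite e))"
    using ends_opposite_disjoint[OF girth e]
    by (simp add: card card_Un_disjoint finite_ends e rev_in)
  also have "\<dots> \<le> card T"
  proof (rule card_mono)
    show "finite T" using T finite_S by (rule finite_subset)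
    show "ends k e \<union> ends k (opposite e) \<subseteq> T"
      using ends_subset[of _ k] e rev_in fst_darts[of T] by blast
  qed
  finally show ?thesis .
qed

end

theorem irregular_moore_bound:
  fixes s k :: nat
  assumes "1 \<le> k" "1 \<le> s" "(s + 1) * card S < card (darts S)"
    and girth: "\<And>xs. is_cycle E xs \<Longrightarrow> 4 * k + 3 \<le> length xs"
  shows "2 * s ^ k < card S"
proof -
  obtain T where T: "T \<subseteq> S" "(s + 1) * card T < card (darts T)"
      and deg: "\<And>v. v \<in> T \<Longrightarrow> 2 \<le> card {e \<in> darts T. fst e = v}"
    using dense_subset_min_degree[OF assms(2,3)] by blast
  interpret dart_graph "darts T" opposite fst
    using T(1) by (rule dart_graph_darts)
  have fin: "finite T" using T(1) finite_S by (rule finite_subset)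
  have "2 \<le> out (fst e)" if "e \<in> darts T" for e
    using that deg fst_darts[of T] unfolding out_def by blast
  moreover have "(s + 1) * card (fst ` darts T) < card (darts T)"
    using T(2) mult_le_mono2[OF card_mono[OF fin fst_darts]] by (rule le_less_trans[rotated])
  ultimately obtain e where e: "e \<in> darts T" "s ^ (2 * k) < walks k e * walks k (opposite e)"
    using exists_many_walks assms(1,2) by blast
  let ?m = "walks k e" and ?n = "walks k (opposite e)"
  \<comment> \<open>The inequality of arithmetic and geometric means, over the integers so that
    \<open>?m - ?n\<close> can be squared.\<close>
  have "(2 * int (s ^ k))\<^sup>2 = 4 * int (s ^ (2 * k))"
    by (simp add: power_mult_distrib power_mult[symmetric] mult.commute)
  also have "\<dots> < 4 * (int ?m * int ?n)"
    using e(2) by (metis mult_strict_left_mono of_nat_less_iff of_nat_mult zero_less_numeral)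
  also have "\<dots> \<le> (int ?m + int ?n)\<^sup>2"
    using zero_le_power2[of "int ?m - int ?n"] by (simp add: power2_eq_square algebra_simps)
  finally have "2 * int (s ^ k) < int ?m + int ?n"
    by (rule power2_less_imp_less) simp
  then have "2 * s ^ k < ?m + ?n" by linarith
  also have "\<dots> \<le> card T"
    using T(1) girth e(1) by (rule walks_opposite_le)
  also have "\<dots> \<le> card S"
    using T(1) finite_S by (rule card_mono[rotated])
  finally show ?thesis .
qed

end

section \<open>Elementary trapping sets\<close>

lemma tanner_graph_edgeD:
  assumes "tanner_graph V C E" "{v, c} \<in> E" "v \<in> V"
  shows "c \<in> C"
  using assms by (auto simp: tanner_graph_def doubleton_eq_iff dest!: subsetD)

lemma degree_variable:
  assumes "tanner_graph V C E" "v \<in> V"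
  shows "degree E v = card {c. {v, c} \<in> E}"
proof -
  have "{e \<in> E. v \<in> e} = (\<lambda>c. {v, c}) ` {c. {v, c} \<in> E}"
    using assms by (fastforce simp: tanner_graph_def)
  moreover have "inj_on (\<lambda>c. {v, c}) X" for X
    by (auto simp: inj_on_def doubleton_eq_iff)
  ultimately show ?thesis by (simp add: degree_def card_image)
qed

text \<open>By bipartiteness the other end of an induced edge at \<open>c\<close> is a variable
  node, hence lies in \<open>S\<close>.\<close>

lemma degree_trapping_edges:
  assumes "tanner_graph V C E" "S \<subseteq> V" "c \<in> C"
  shows "degree (trapping_edges C E S) c = card {v \<in> S. {v, c} \<in> E}"
proof -
  have "{e \<in> trapping_edges C E S. c \<in> e} = (\<lambda>v. {v, c}) ` {v \<in> S. {v, c} \<in> E}"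
  proof (intro equalityI subsetI)
    fix e assume "e \<in> {e \<in> trapping_edges C E S. c \<in> e}"
    then have e: "e \<in> E" "e \<subseteq> S \<union> C" "c \<in> e"
      by (auto simp: trapping_edges_def induced_edges_def adjacent_checks_def)
    then obtain v d where "e = {v, d}" "v \<in> V" "d \<in> C"
      using assms(1) by (auto simp: tanner_graph_def)
    moreover have "V \<inter> C = {}" using assms(1) by (simp add: tanner_graph_def)
    ultimately show "e \<in> (\<lambda>v. {v, c}) ` {v \<in> S. {v, c} \<in> E}"
      using e assms(2,3) by auto
  qed (use assms(3) in \<open>auto simp: trapping_edges_def induced_edges_def adjacent_checks_def\<close>)
  moreover have "inj_on (\<lambda>v. {v, c}) X" for X
    by (auto simp: inj_on_def doubleton_eq_iff)
  ultimately show ?thesis by (simp add: degree_def card_image)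
qed

text \<open>One of the first two vertices of the cycle is a variable node, and its neighbours on the
  cycle are two different checks.\<close>

lemma column_weight_ge_2:
  assumes tanner: "tanner_graph V C E" and reg: "variable_regular V E \<gamma>" and cycle: "is_cycle E xs"
  shows "2 \<le> \<gamma>"
proof -
  have len: "3 \<le> length xs" and dist: "distinct xs"
    and edge: "\<And>i. i < length xs \<Longrightarrow> {xs ! i, xs ! (Suc i mod length xs)} \<in> E"
    using cycle by (auto simp: is_cycle_def)
  have *: "2 \<le> \<gamma>" if "v \<in> V" "{v, c} \<in> E" "{v, d} \<in> E" "c \<noteq> d" for v c d
  proof -
    have "{c. {v, c} \<in> E} \<subseteq> C" "finite C"
      using tanner that(1) tanner_graph_edgeD[OF tanner] by (auto simp: tanner_graph_def)
    then have "card {c, d} \<le> card {c. {v, c} \<in> E}"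
      using that by (intro card_mono) (auto intro: finite_subset)
    then show ?thesis
      using that reg degree_variable[OF tanner that(1)] by (simp add: variable_regular_def)
  qed
  have e: "{xs ! 0, xs ! 1} \<in> E" "{xs ! 1, xs ! 2} \<in> E" "{xs ! (length xs - 1), xs ! 0} \<in> E"
  proof -
    have "Suc 0 mod length xs = 1" "Suc 1 mod length xs = 2"
      "0 < length xs" "1 < length xs" "Suc (length xs - 1) = length xs"
      using len by auto
    then show "{xs ! 0, xs ! 1} \<in> E" "{xs ! 1, xs ! 2} \<in> E" "{xs ! (length xs - 1), xs ! 0} \<in> E"
      using edge[of 0] edge[of 1] edge[of "length xs - 1"] by simp_all
  qed
  have n: "xs ! 0 \<noteq> xs ! 2" "xs ! (length xs - 1) \<noteq> xs ! 1"
    using dist len by (subst nth_eq_iff_index_eq; auto)+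
  have "xs ! 0 \<in> V \<or> xs ! 1 \<in> V"
    using e(1) tanner by (auto simp: tanner_graph_def doubleton_eq_iff dest!: subsetD)
  then show ?thesis
    using *[of "xs ! 0" "xs ! 1" "xs ! (length xs - 1)"] *[of "xs ! 1" "xs ! 0" "xs ! 2"] e n
    by (auto simp: insert_commute)
qed

lemma trapping_set_imp_elementary:
  assumes tanner: "tanner_graph V C E" and ets: "elementary_trapping_set V C E a b S"
  shows "elementary E S"
proof
  have SV: "S \<subseteq> V"
    using ets by (simp add: elementary_trapping_set_def trapping_set_def)
  have fin: "finite V" "finite C" using tanner by (auto simp: tanner_graph_def)
  show "finite S" using SV fin finite_subset by blast
  show "finite (\<Union>E)"
    by (rule finite_subset[of _ "V \<union> C"]) (use tanner in \<open>auto simp: tanner_graph_def\<close>)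
  show "{x} \<notin> E" for x
    using tanner by (fastforce simp: tanner_graph_def)
  fix u v w c
  assume A: "u \<in> S" "v \<in> S" "w \<in> S" "{u, c} \<in> E" "{v, c} \<in> E" "{w, c} \<in> E" "u \<noteq> v"
  have c: "c \<in> C" using A SV tanner_graph_edgeD[OF tanner] by blast
  then have "c \<in> adjacent_checks C E S" using A by (auto simp: adjacent_checks_def)
  then have "card {v \<in> S. {v, c} \<in> E} \<le> 2"
    using ets degree_trapping_edges[OF tanner SV c] by (auto simp: elementary_trapping_set_def)
  moreover have "card {u, v, w} \<le> card {v \<in> S. {v, c} \<in> E}"
    using A \<open>finite S\<close> by (intro card_mono) auto
  ultimately show "w = u \<or> w = v"
    using A(7) by (auto simp: card_insert_if split: if_splits)
qed

text \<open>Of the \<open>\<gamma> * a\<close> incidences at \<open>S\<close>, those that are not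
  darts belong to checks of degree one, and each such check has only one.\<close>

lemma card_darts_trapping_set:
  assumes tanner: "tanner_graph V C E" and reg: "variable_regular V E \<gamma>"
    and ets: "elementary_trapping_set V C E a b S"
  shows "\<gamma> * a \<le> card (elementary.darts E S) + b"
proof -
  interpret elementary E S
    using tanner ets by (rule trapping_set_imp_elementary)
  have S: "S \<subseteq> V" "card S = a"
    and b: "card {c \<in> adjacent_checks C E S. odd (degree (trapping_edges C E S) c)} = b"
    using ets by (auto simp: elementary_trapping_set_def trapping_set_def)
  let ?O = "{c \<in> adjacent_checks C E S. odd (degree (trapping_edges C E S) c)}"
  let ?N = "\<lambda>v. {c. {v, c} \<in> E}"
  let ?A = "SIGMA v:S. ?N v"
  have finN: "finite (?N v)" for v
    by (rule finite_subset[OF _ finite_nodes]) auto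
  have "card ?A = (\<Sum>v\<in>S. card (?N v))"
    using finite_S finN by (simp add: card_SigmaI)
  also have "\<dots> = (\<Sum>v\<in>S. \<gamma>)"
    using S(1) reg degree_variable[OF tanner] by (intro sum.cong refl) (auto simp: variable_regular_def)
  finally have A: "card ?A = \<gamma> * a" using S(2) by simp
  have single: "w = v" if "(v, c) \<in> ?A - darts S" "w \<in> S" "{w, c} \<in> E" for v w c
    using that by (auto simp: darts_def)
  have "card (?A - darts S) \<le> card ?O"
  proof (rule card_inj_on_le)
    show "inj_on snd (?A - darts S)"
      using single by (auto simp: inj_on_def)
    show "snd ` (?A - darts S) \<subseteq> ?O"
    proof
      fix c assume "c \<in> snd ` (?A - darts S)"
      then obtain v where vc: "(v, c) \<in> ?A" "(v, c) \<notin> darts S" by auto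
      then have c: "c \<in> C" using S(1) tanner_graph_edgeD[OF tanner] by blast
      have "{w \<in> S. {w, c} \<in> E} = {v}"
        using vc single by auto
      then have "odd (degree (trapping_edges C E S) c)"
        using degree_trapping_edges[OF tanner S(1) c] by simp
      moreover have "c \<in> adjacent_checks C E S"
        using vc c by (auto simp: adjacent_checks_def)
      ultimately show "c \<in> ?O" by blast
    qed
    show "finite ?O"
      using tanner by (simp add: tanner_graph_def adjacent_checks_def)
  qed
  moreover have "card ?A - card (darts S) \<le> card (?A - darts S)"
    by (rule diff_card_le_card_Diff[OF finite_darts_set])
  ultimately show ?thesis using A b by linarith
qed

theorem theorem9:
  fixes V C :: "'a set" and E :: "'a set set" and k \<gamma> :: nat
  assumes "k \<ge> 1"
    and "tanner_graph V C E"
    and "variable_regular V E \<gamma>"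
    and "girth E = enat (2 * (2 * k + 2))"
  shows "\<not> (\<exists>(S :: 'a set) (a :: nat) (b :: nat).
           elementary_trapping_set V C E a b S \<and>
           real b / real a < 1 \<and> real a \<le> 2 * (real \<gamma> - 2) ^ k)"
proof
  assume "\<exists>(S :: 'a set) (a :: nat) (b :: nat).
           elementary_trapping_set V C E a b S \<and>
           real b / real a < 1 \<and> real a \<le> 2 * (real \<gamma> - 2) ^ k"
  then obtain S a b where ets: "elementary_trapping_set V C E a b S"
    and ratio: "real b / real a < 1" and small: "real a \<le> 2 * (real \<gamma> - 2) ^ k"
    by blast
  interpret elementary E S
    using assms(2) ets by (rule trapping_set_imp_elementary)
  have S: "S \<noteq> {}" "card S = a"
    using ets by (auto simp: elementary_trapping_set_def trapping_set_def)
  have a: "0 < a" using S finite_S by (auto simp: card_gt_0_iff)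
  then have ba: "b < a" using ratio by (simp add: field_simps)
  have cycles: "4 * k + 3 \<le> length xs" if "is_cycle E xs" for xs
  proof -
    have "girth E \<le> enat (length xs)"
      unfolding girth_def using that by (intro INF_lower) simp
    then show ?thesis using assms(4) by simp
  qed
  \<comment> \<open>The infimum over no cycles would be infinite.\<close>
  obtain xs where "is_cycle E xs"
    using assms(4) by (force simp: girth_def top_enat_def)
  then have "2 \<le> \<gamma>"
    using column_weight_ge_2 assms(2,3) by blast
  then obtain s where s: "\<gamma> = s + 2"
    by (metis add.commute le_Suc_ex)
  have "real a \<le> real (2 * s ^ k)" using small s by simp
  then have le: "a \<le> 2 * s ^ k" by (simp only: of_nat_le_iff)
  \<comment> \<open>For \<open>s = 0\<close> the size bound would be 0, as \<open>k\<close> is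
    positive.\<close>
  then have "1 \<le> s" using a assms(1) by (cases "s = 0") (auto simp: power_0_left)
  \<comment> \<open>From \<open>b < a\<close>:
    \<open>\<gamma> * a - b > (\<gamma> - 1) * a = (s + 1) * a\<close>.\<close>
  moreover have "(s + 1) * card S < card (darts S)"
    using card_darts_trapping_set[OF assms(2,3) ets] ba S(2) s by (simp add: algebra_simps)
  ultimately have "2 * s ^ k < card S"
    using irregular_moore_bound[OF assms(1) _ _ cycles] by blast
  then show False using le S(2) by simp
qed

end
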